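(* Any nonsingular $\mathcal{C}^2$ map $F:\mathbb{R}^n\to\mathbb{R}^n$ can be extended to a $\mathcal{C}^1$ nonsingular map $G:\mathbb{R}^{2n}\to\mathbb{R}^{2n}$ such that (1) the Jacobian matrix of $G$ is symmetric, (2) $F$ is an everywhere defined real rational map if, and only if, $G$ is, (3) $F$ is polynomial if, and only if, $G$ is, and (4) a finite bound on the cardinality of fibers holds for $F$ if, and only if, the same bound holds for $G$; that is, for every positive integer $b$, every fiber of $F$ has at most $b$ elements if, and only if, every fiber of $G$ has at most $b$ elements.
   Context: A map is nonsingular if its Jacobian determinant is nonzero at every point. "$F$ can be extended to $G$" is meant in the sense that, in coordinates $(v,x)\in\mathbb{R}^n\times\mathbb{R}^n=\mathbb{R}^{2n}$, the first $n$ components of $G(v,x)$ are those of $F(x)$. An everywhere defined real rational map is one each of whose components can be written as a fraction of real polynomials with denominator vanishing nowhere. The fibers of a map are the inverse images of points of the codomain. *)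

theory Defs
  imports "HOL-Analysis.Analysis"
begin

(* Maps of class C^k on the whole space: k = 0 is continuity; f is C^(k+1) if it is (Frechet)
   differentiable everywhere and each of its partial derivatives, taken along the standard
   basis vectors, is C^k.  Requiring Frechet differentiability costs nothing, since existence
   and continuity of all partial derivatives imply it. *)
primrec C_k :: "nat \<Rightarrow> ('a::euclidean_space \<Rightarrow> 'b::real_normed_vector) \<Rightarrow> bool" where
  "C_k 0 f \<longleftrightarrow> continuous_on UNIV f"
| "C_k (Suc k) f \<longleftrightarrow>
     (\<forall>x. f differentiable (at x)) \<and>
     (\<forall>e\<in>Basis. C_k k (\<lambda>x. frechet_derivative f (at x) e))"

definition nonsingular :: "(real^'n \<Rightarrow> real^'n) \<Rightarrow> bool" where
  "nonsingular f \<longleftrightarrow> (\<forall>x. det (jacobian f (at x)) \<noteq> 0)"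

definition symmetric_jacobian :: "(real^'n \<Rightarrow> real^'n) \<Rightarrow> bool" where
  "symmetric_jacobian f \<longleftrightarrow> (\<forall>x. transpose (jacobian f (at x)) = jacobian f (at x))"

(* R^(2n) is real^('n + 'n): the index Inl i is the i-th of the first n coordinates and
   Inr i is the i-th of the last n coordinates. *)
definition join_vec :: "real^'n \<Rightarrow> real^'n \<Rightarrow> real^('n + 'n)" where
  "join_vec v x = (\<chi> k. case k of Inl i \<Rightarrow> v $ i | Inr i \<Rightarrow> x $ i)"

definition extends_map ::
    "(real^('n + 'n) \<Rightarrow> real^('n + 'n)) \<Rightarrow> (real^'n \<Rightarrow> real^'n) \<Rightarrow> bool" where
  "extends_map G F \<longleftrightarrow> (\<forall>v x i. G (join_vec v x) $ Inl i = F x $ i)"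

definition everywhere_defined_rational :: "(real^'m \<Rightarrow> real^'n) \<Rightarrow> bool" where
  "everywhere_defined_rational f \<longleftrightarrow>
     (\<forall>i. \<exists>p q. real_polynomial_function p \<and> real_polynomial_function q \<and>
        (\<forall>x. q x \<noteq> 0) \<and> (\<forall>x. f x $ i = p x / q x))"

definition fibers_at_most :: "nat \<Rightarrow> ('a \<Rightarrow> 'b) \<Rightarrow> bool" where
  "fibers_at_most b f \<longleftrightarrow> (\<forall>y. finite (f -` {y}) \<and> card (f -` {y}) \<le> b)"

end

theory Submission
  imports Defs
begin

text \<open>Take for \<open>G\<close> the gradient of \<open>(v, x) \<mapsto> v \<bullet> F x\<close>, that is
  \<open>G (v, x) = (F x, (F' x)\<^sup>T v)\<close>.  Its Jacobian matrix is a Hessian, hence symmetric, and has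
  the block form \<open>(0, F' x; (F' x)\<^sup>T, *)\<close>, hence is invertible.  Since \<open>(F' x)\<^sup>T\<close> is invertible,
  every point of a fiber of \<open>F\<close> has exactly one point above it in each corresponding fiber
  of \<open>G\<close>.\<close>

section \<open>Equality of mixed derivatives\<close>

text \<open>Two uses of the mean value theorem, first along \<open>u\<close> and then along
  \<open>w\<close>. Only the derivative of \<open>f' y u\<close> enters, so the lemma can be applied
  a second time with the roles of \<open>u\<close> and \<open>w\<close> exchanged.\<close>

lemma second_difference_mvt:
  fixes f :: "'a::real_normed_vector \<Rightarrow> real"
  assumes f: "\<And>x. (f has_derivative f' x) (at x)"
    and f': "\<And>x. ((\<lambda>y. f' y u) has_derivative D x) (at x)"
    and "h > 0"
  obtains a b where "0 < a" "a < h" "0 < b" "b < h"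
    "f (x + h *\<^sub>R u + h *\<^sub>R w) - f (x + h *\<^sub>R u) - f (x + h *\<^sub>R w) + f x
      = h\<^sup>2 * D (x + a *\<^sub>R u + b *\<^sub>R w) w"
proof -
  \<comment> \<open>The second difference is the increment \<open>g h - g 0\<close>.\<close>
  define g where "g s = f (x + s *\<^sub>R u + h *\<^sub>R w) - f (x + s *\<^sub>R u)" for s
  have g: "(g has_real_derivative f' (x + s *\<^sub>R u + h *\<^sub>R w) u - f' (x + s *\<^sub>R u) u) (at s)" for s
  proof -
    note lin = bounded_linear.linear[OF has_derivative_bounded_linear[OF f]]
    have "((\<lambda>t. f (x + t *\<^sub>R u + c)) has_derivative (\<lambda>t. f' (x + s *\<^sub>R u + c) (t *\<^sub>R u))) (at s)" for c
      by (rule has_derivative_compose[OF _ f]) (auto intro!: derivative_eq_intros)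
    from has_derivative_diff[OF this[of "h *\<^sub>R w"] this[of 0]]
    have "(g has_derivative (\<lambda>t. f' (x + s *\<^sub>R u + h *\<^sub>R w) (t *\<^sub>R u) - f' (x + s *\<^sub>R u) (t *\<^sub>R u))) (at s)"
      by (simp add: g_def[abs_def])
    then show ?thesis
      unfolding has_field_derivative_def
      by (rule has_derivative_eq_rhs) (simp add: fun_eq_iff linear_cmul[OF lin] algebra_simps)
  qed
  obtain a where a: "0 < a" "a < h"
    "g h - g 0 = (h - 0) * (f' (x + a *\<^sub>R u + h *\<^sub>R w) u - f' (x + a *\<^sub>R u) u)"
    using MVT2[OF \<open>h > 0\<close> g] by blast
  \<comment> \<open>The value of the derivative of \<open>g\<close> at \<open>a\<close> is in turn
    the increment \<open>k h - k 0\<close>, now in the direction \<open>w\<close>.\<close>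
  define k where "k t = f' (x + a *\<^sub>R u + t *\<^sub>R w) u" for t
  have k: "(k has_real_derivative D (x + a *\<^sub>R u + t *\<^sub>R w) w) (at t)" for t
  proof -
    note lin = bounded_linear.linear[OF has_derivative_bounded_linear[OF f']]
    have "(k has_derivative (\<lambda>s. D (x + a *\<^sub>R u + t *\<^sub>R w) (s *\<^sub>R w))) (at t)"
      unfolding k_def
      by (intro has_derivative_compose[OF _ f']) (auto intro!: derivative_eq_intros)
    then show ?thesis
      unfolding has_field_derivative_def
      by (rule has_derivative_eq_rhs) (simp add: fun_eq_iff linear_cmul[OF lin] algebra_simps)
  qed
  obtain b where b: "0 < b" "b < h" "k h - k 0 = (h - 0) * D (x + a *\<^sub>R u + b *\<^sub>R w) w"
    using MVT2[OF \<open>h > 0\<close> k] by blast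
  show thesis
    by (rule that[OF a(1,2) b(1,2)]) (use a(3) b(3) in \<open>simp add: g_def k_def power2_eq_square\<close>)
qed

text \<open>The second difference of \<open>f\<close> is symmetric in \<open>u\<close> and
  \<open>w\<close>. Evaluating it in both orders gives a value of \<open>Du\<close> and a value of
  \<open>Dw\<close> that agree at two points near \<open>x\<close>; continuity at \<open>x\<close>
  carries the equality to \<open>x\<close> itself.\<close>

lemma mixed_derivatives_eq:
  fixes f :: "'a::real_normed_vector \<Rightarrow> real"
  assumes f: "\<And>x. (f has_derivative f' x) (at x)"
    and u: "\<And>x. ((\<lambda>y. f' y u) has_derivative Du x) (at x)"
    and w: "\<And>x. ((\<lambda>y. f' y w) has_derivative Dw x) (at x)"
    and contu: "isCont (\<lambda>y. Du y w) x" and contw: "isCont (\<lambda>y. Dw y u) x"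
  shows "Du x w = Dw x u"
proof (rule ccontr)
  assume "Du x w \<noteq> Dw x u"
  \<comment> \<open>Half the gap: no number lies strictly within \<open>e\<close> of both
    \<open>Du x w\<close> and \<open>Dw x u\<close>.\<close>
  define e where "e = \<bar>Du x w - Dw x u\<bar> / 2"
  have "e > 0" using \<open>Du x w \<noteq> Dw x u\<close> by (simp add: e_def)
  obtain d1 where d1: "d1 > 0" "\<And>y. dist y x < d1 \<Longrightarrow> dist (Du y w) (Du x w) < e"
    using contu \<open>e > 0\<close> unfolding continuous_at_eps_delta by metis
  obtain d2 where d2: "d2 > 0" "\<And>y. dist y x < d2 \<Longrightarrow> dist (Dw y u) (Dw x u) < e"
    using contw \<open>e > 0\<close> unfolding continuous_at_eps_delta by metis
  \<comment> \<open>Small enough that every intermediate point delivered by the mean value theorem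
    is within \<open>d1\<close> and \<open>d2\<close> of \<open>x\<close>; the summand 1 keeps the
    denominator positive when \<open>u\<close> and \<open>w\<close> are both zero.\<close>
  define h where "h = min d1 d2 / (norm u + norm w + 1)"
  have pos: "norm u + norm w + 1 > 0"
    by (simp add: add_nonneg_pos)
  have "h > 0" using d1(1) d2(1) pos by (simp add: h_def)
  have near: "norm (a *\<^sub>R u + b *\<^sub>R w) < min d1 d2"
    if "0 < a" "a < h" "0 < b" "b < h" for a b
  proof -
    have "norm (a *\<^sub>R u + b *\<^sub>R w) \<le> a * norm u + b * norm w"
      using norm_triangle_ineq[of "a *\<^sub>R u" "b *\<^sub>R w"] that by simp
    also have "\<dots> \<le> h * norm u + h * norm w"
      using that by (intro add_mono mult_right_mono) auto
    also have "\<dots> < h * (norm u + norm w + 1)"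
      using \<open>h > 0\<close> by (simp add: algebra_simps)
    also have "\<dots> = min d1 d2"
      using pos by (simp add: h_def)
    finally show ?thesis .
  qed
  obtain a b where ab: "0 < a" "a < h" "0 < b" "b < h"
    "f (x + h *\<^sub>R u + h *\<^sub>R w) - f (x + h *\<^sub>R u) - f (x + h *\<^sub>R w) + f x
      = h\<^sup>2 * Du (x + a *\<^sub>R u + b *\<^sub>R w) w"
    using second_difference_mvt[OF f u \<open>h > 0\<close>] by blast
  obtain c d where cd: "0 < c" "c < h" "0 < d" "d < h"
    "f (x + h *\<^sub>R w + h *\<^sub>R u) - f (x + h *\<^sub>R w) - f (x + h *\<^sub>R u) + f x
      = h\<^sup>2 * Dw (x + c *\<^sub>R w + d *\<^sub>R u) u"
    using second_difference_mvt[OF f w \<open>h > 0\<close>] by blast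
  have "h\<^sup>2 * Du (x + a *\<^sub>R u + b *\<^sub>R w) w = h\<^sup>2 * Dw (x + c *\<^sub>R w + d *\<^sub>R u) u"
    using ab(5) cd(5) by (simp add: algebra_simps)
  then have "Du (x + a *\<^sub>R u + b *\<^sub>R w) w = Dw (x + c *\<^sub>R w + d *\<^sub>R u) u"
    using \<open>h > 0\<close> by simp
  moreover have "dist (Du (x + a *\<^sub>R u + b *\<^sub>R w) w) (Du x w) < e"
    using near[OF ab(1-4)] by (intro d1(2)) (simp add: dist_norm add.assoc)
  moreover have "dist (Dw (x + c *\<^sub>R w + d *\<^sub>R u) u) (Dw x u) < e"
    using near[OF cd(3,4,1,2)] by (intro d2(2)) (simp add: dist_norm add.commute add.left_commute)
  ultimately show False
    by (simp add: e_def dist_real_def abs_if field_simps split: if_splits)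
qed

section \<open>Polynomial and rational functions\<close>

text \<open>Induction on the construction of \<open>p\<close> by the sum and product rules. The
  direction \<open>v\<close> is held fixed, so each directional derivative is a scalar function of
  the base point and can again be polynomial.\<close>

lemma real_polynomial_function_has_derivative:
  assumes "real_polynomial_function p"
  obtains p' where "\<And>x. (p has_derivative p' x) (at x)"
    "\<And>v. real_polynomial_function (\<lambda>x. p' x v)"
proof -
  have "\<exists>p'. (\<forall>x. (p has_derivative p' x) (at x)) \<and> (\<forall>v. real_polynomial_function (\<lambda>x. p' x v))"
    using assms
  proof induction
    case (linear f)
    then show ?case
      by (intro exI[of _ "\<lambda>_. f"]) (auto intro: bounded_linear_imp_has_derivative)
  next
    case (const c)
    show ?case by (intro exI[of _ "\<lambda>_ _. 0"]) auto
  next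
    case (add f g)
    then obtain f' g' where
      "\<And>x. (f has_derivative f' x) (at x)" "\<And>v. real_polynomial_function (\<lambda>x. f' x v)"
      "\<And>x. (g has_derivative g' x) (at x)" "\<And>v. real_polynomial_function (\<lambda>x. g' x v)"
      by blast
    then show ?case
      by (intro exI[of _ "\<lambda>x v. f' x v + g' x v"]) (auto intro!: has_derivative_add)
  next
    case (mult f g)
    then obtain f' g' where
      "\<And>x. (f has_derivative f' x) (at x)" "\<And>v. real_polynomial_function (\<lambda>x. f' x v)"
      "\<And>x. (g has_derivative g' x) (at x)" "\<And>v. real_polynomial_function (\<lambda>x. g' x v)"
      by blast
    with mult.hyps show ?case
      by (intro exI[of _ "\<lambda>x v. f x * g' x v + f' x v * g x"])
        (intro conjI allI has_derivative_mult real_polynomial_function.intros(3,4); simp)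
  qed
  then show thesis using that by blast
qed

text \<open>The condition that \<open>everywhere_defined_rational\<close> puts on each component,
  isolated so that closure under the operations that build \<open>G\<close> can be proved for scalar
  functions.\<close>

definition rational_function :: "('a::real_normed_vector \<Rightarrow> real) \<Rightarrow> bool" where
  "rational_function f \<longleftrightarrow> (\<exists>p q. real_polynomial_function p \<and> real_polynomial_function q \<and>
     (\<forall>x. q x \<noteq> 0) \<and> (\<forall>x. f x = p x / q x))"

lemma rational_functionI:
  assumes "real_polynomial_function p" "real_polynomial_function q"
    "\<And>x. q x \<noteq> 0" "\<And>x. f x = p x / q x"
  shows "rational_function f"
  using assms unfolding rational_function_def by blast

lemma rational_functionE:
  assumes "rational_function f"
  obtains p q where "real_polynomial_function p" "real_polynomial_function q"
    "\<And>x. q x \<noteq> 0" "f = (\<lambda>x. p x / q x)"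
  using assms unfolding rational_function_def by blast

lemma everywhere_defined_rational_iff:
  "everywhere_defined_rational f \<longleftrightarrow> (\<forall>i. rational_function (\<lambda>x. f x $ i))"
  by (simp add: everywhere_defined_rational_def rational_function_def)

lemma rational_function_polynomial: "real_polynomial_function p \<Longrightarrow> rational_function p"
  by (rule rational_functionI[where q = "\<lambda>_. 1"]) auto

lemma rational_function_add:
  assumes "rational_function f" "rational_function g"
  shows "rational_function (\<lambda>x. f x + g x)"
proof -
  obtain p q where f: "real_polynomial_function p" "real_polynomial_function q"
    "\<And>x. q x \<noteq> 0" "f = (\<lambda>x. p x / q x)"
    using assms(1) by (rule rational_functionE) (rule that)
  obtain r s where g: "real_polynomial_function r" "real_polynomial_function s"
    "\<And>x. s x \<noteq> 0" "g = (\<lambda>x. r x / s x)"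
    using assms(2) by (rule rational_functionE) (rule that)
  show ?thesis
    by (rule rational_functionI[where p = "\<lambda>x. p x * s x + r x * q x" and q = "\<lambda>x. q x * s x"])
      (use f g in \<open>auto simp: add_frac_eq\<close>)
qed

lemma rational_function_mult:
  assumes "rational_function f" "rational_function g"
  shows "rational_function (\<lambda>x. f x * g x)"
proof -
  obtain p q where f: "real_polynomial_function p" "real_polynomial_function q"
    "\<And>x. q x \<noteq> 0" "f = (\<lambda>x. p x / q x)"
    using assms(1) by (rule rational_functionE) (rule that)
  obtain r s where g: "real_polynomial_function r" "real_polynomial_function s"
    "\<And>x. s x \<noteq> 0" "g = (\<lambda>x. r x / s x)"
    using assms(2) by (rule rational_functionE) (rule that)
  show ?thesis
    by (rule rational_functionI[where p = "\<lambda>x. p x * r x" and q = "\<lambda>x. q x * s x"])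
      (use f g in auto)
qed

lemma rational_function_sum:
  "finite I \<Longrightarrow> (\<And>i. i \<in> I \<Longrightarrow> rational_function (f i)) \<Longrightarrow> rational_function (\<lambda>x. \<Sum>i\<in>I. f i x)"
  by (induction I rule: finite_induct)
    (auto intro: rational_function_add rational_function_polynomial)

lemma real_polynomial_function_compose_linear:
  "real_polynomial_function p \<Longrightarrow> bounded_linear L \<Longrightarrow> real_polynomial_function (\<lambda>x. p (L x))"
  using real_polynomial_function_compose[OF polynomial_function_bounded_linear, of L p]
  by (simp add: o_def)

lemma rational_function_compose_linear:
  assumes "rational_function f" "bounded_linear L"
  shows "rational_function (\<lambda>x. f (L x))"
proof -
  obtain p q where f: "real_polynomial_function p" "real_polynomial_function q"
    "\<And>x. q x \<noteq> 0" "f = (\<lambda>x. p x / q x)"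
    using assms(1) by (rule rational_functionE) (rule that)
  show ?thesis
    by (rule rational_functionI[OF real_polynomial_function_compose_linear[OF f(1) assms(2)]
          real_polynomial_function_compose_linear[OF f(2) assms(2)]]) (simp_all add: f(3,4))
qed

text \<open>The quotient rule; its denominator \<open>q x * q x\<close> vanishes nowhere because
  \<open>q\<close> does not. This is what lets the derivatives of \<open>F\<close> appear in a
  rational \<open>G\<close>.\<close>

lemma rational_function_has_derivative:
  assumes "rational_function f"
  obtains f' where "\<And>x. (f has_derivative f' x) (at x)" "\<And>v. rational_function (\<lambda>x. f' x v)"
proof -
  obtain p q where f: "real_polynomial_function p" "real_polynomial_function q"
    "\<And>x. q x \<noteq> 0" "f = (\<lambda>x. p x / q x)"
    using assms by (rule rational_functionE) (rule that)
  obtain p' where p': "\<And>x. (p has_derivative p' x) (at x)"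
    "\<And>v. real_polynomial_function (\<lambda>x. p' x v)"
    using real_polynomial_function_has_derivative[OF f(1)] by blast
  obtain q' where q': "\<And>x. (q has_derivative q' x) (at x)"
    "\<And>v. real_polynomial_function (\<lambda>x. q' x v)"
    using real_polynomial_function_has_derivative[OF f(2)] by blast
  show thesis
  proof
    show "(f has_derivative (\<lambda>v. (p' x v * q x - p x * q' x v) / (q x * q x))) (at x)" for x
      unfolding f(4) by (rule has_derivative_divide'[OF p'(1) q'(1) f(3)])
    show "rational_function (\<lambda>x. (p' x v * q x - p x * q' x v) / (q x * q x))" for v
      by (rule rational_functionI[where p = "\<lambda>x. p' x v * q x - p x * q' x v"
            and q = "\<lambda>x. q x * q x"])
        (use f(3) in \<open>auto intro!: real_polynomial_function_diff
          real_polynomial_function.intros(4) f(1,2) p'(2) q'(2)\<close>)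
  qed
qed

text \<open>By uniqueness of derivatives, the components of the abstractly chosen
  \<open>frechet_derivative\<close> are the explicit derivatives obtained for polynomial and
  rational components.\<close>

lemma frechet_derivative_nth:
  fixes F :: "'a::real_normed_vector \<Rightarrow> real^'n"
  assumes "F differentiable (at x)" "((\<lambda>y. F y $ i) has_derivative D) (at x)"
  shows "frechet_derivative F (at x) v $ i = D v"
proof -
  have "((\<lambda>y. F y $ i) has_derivative (\<lambda>v. frechet_derivative F (at x) v $ i)) (at x)"
    using assms(1) frechet_derivative_works
    by (intro bounded_linear.has_derivative[OF bounded_linear_vec_nth]) blast
  from has_derivative_unique[OF this assms(2)] show ?thesis by metis
qed

lemma polynomial_function_iff_nth:
  fixes f :: "'a::real_normed_vector \<Rightarrow> real^'n"
  shows "polynomial_function f \<longleftrightarrow> (\<forall>i. real_polynomial_function (\<lambda>x. f x $ i))"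
  by (auto simp: polynomial_function_iff_Basis_inner Basis_vec_def inner_axis)

section \<open>The gradient extension\<close>

definition first_half :: "real^('n + 'n) \<Rightarrow> real^'n" where
  "first_half w = (\<chi> i. w $ Inl i)"

definition last_half :: "real^('n + 'n) \<Rightarrow> real^'n" where
  "last_half w = (\<chi> i. w $ Inr i)"

definition gradient_extension :: "(real^'n \<Rightarrow> real^'n) \<Rightarrow> real^('n + 'n) \<Rightarrow> real^('n + 'n)" where
  "gradient_extension F w = join_vec (F (last_half w))
     (transpose (jacobian F (at (last_half w))) *v first_half w)"

lemma half_nth [simp]: "first_half w $ i = w $ Inl i" "last_half w $ i = w $ Inr i"
  by (simp_all add: first_half_def last_half_def)

lemma join_vec_nth [simp]: "join_vec v x $ Inl i = v $ i" "join_vec v x $ Inr i = x $ i"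
  by (simp_all add: join_vec_def)

lemma half_join_vec [simp]: "first_half (join_vec v x) = v" "last_half (join_vec v x) = x"
  by (simp_all add: vec_eq_iff)

lemma vec_sum_eq_iff:
  "v = w \<longleftrightarrow> first_half v = first_half w \<and> last_half v = last_half w"
  by (simp add: vec_eq_iff split_sum_all)

lemma bounded_linear_last_half: "bounded_linear last_half"
  unfolding last_half_def
  by (intro linear_linear[THEN iffD2] linearI) (simp_all add: vec_eq_iff)

text \<open>Written out, coordinate \<open>Inr j\<close> is the inner product of v with the j-th
  partial derivative of \<open>F\<close>: a finite sum of products from which derivatives and
  polynomiality can be read off.\<close>

lemma gradient_extension_nth:
  "gradient_extension F w $ Inl i = F (last_half w) $ i"
  "gradient_extension F w $ Inr j =
     (\<Sum>i\<in>UNIV. w $ Inl i * frechet_derivative F (at (last_half w)) (axis j 1) $ i)"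
  by (simp_all add: gradient_extension_def matrix_vector_mult_def transpose_def jacobian_def
      matrix_def mult.commute)

lemma sum_axis_mult: "(\<Sum>i\<in>UNIV. axis j 1 $ i * c i) = (c j :: real)"
  by (simp add: axis_def if_distrib[of "\<lambda>x. x * _"] cong: if_cong)

lemma axis_halves [simp]:
  "first_half (axis (Inl k) 1) = axis k 1" "last_half (axis (Inl k) 1) = 0"
  "first_half (axis (Inr k) 1) = 0" "last_half (axis (Inr k) 1) = axis k 1"
  by (auto simp: vec_eq_iff axis_def)

section \<open>First and second partial derivatives of a C^2 map\<close>

locale C2_map =
  fixes F :: "real^'n \<Rightarrow> real^'n"
  assumes C2: "C_k 2 F"
begin

definition D :: "real^'n \<Rightarrow> real^'n \<Rightarrow> real^'n" where
  "D x = frechet_derivative F (at x)"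

text \<open>The value \<open>D2 j x (axis k 1)\<close> is the second partial derivative of
  \<open>F\<close>, first along j and then along k. Indexing by a coordinate matches
  \<open>C_k\<close>, which speaks of partial derivatives along basis vectors only.\<close>

definition D2 :: "'n \<Rightarrow> real^'n \<Rightarrow> real^'n \<Rightarrow> real^'n" where
  "D2 j x = frechet_derivative (\<lambda>y. D y (axis j 1)) (at x)"

lemma axis_Basis: "axis j (1::real) \<in> Basis"
  by (simp add: axis_in_Basis_iff)

lemma differentiable: "F differentiable (at x)"
  using C2 by (simp add: numeral_2_eq_2)

lemma D: "(F has_derivative D x) (at x)"
  using differentiable frechet_derivative_works unfolding D_def by blast

lemma D2: "((\<lambda>y. D y (axis j 1)) has_derivative D2 j x) (at x)"
  using C2 axis_Basis[of j] frechet_derivative_works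
  unfolding D2_def D_def by (fastforce simp: numeral_2_eq_2)

lemma linear_D: "linear (D x)"
  using D has_derivative_linear by blast

lemma linear_D2: "linear (D2 j x)"
  using D2 has_derivative_linear by blast

lemma continuous_D: "continuous_on UNIV (\<lambda>x. D x (axis j 1))"
  using D2 has_derivative_continuous continuous_at_imp_continuous_on by blast

lemma continuous_D2: "continuous_on UNIV (\<lambda>x. D2 j x (axis k 1))"
  using C2 axis_Basis[of j] axis_Basis[of k]
  unfolding D2_def D_def by (fastforce simp: numeral_2_eq_2)

text \<open>Schwarz's theorem for each component of \<open>F\<close>; it will make the lower right
  block of the Jacobian matrix of \<open>G\<close> symmetric.\<close>

lemma D2_sym: "D2 j x (axis k 1) $ i = D2 k x (axis j 1) $ i"
proof (rule mixed_derivatives_eq[where f = "\<lambda>x. F x $ i" and f' = "\<lambda>x v. D x v $ i"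
      and Du = "\<lambda>x v. D2 j x v $ i" and Dw = "\<lambda>x v. D2 k x v $ i"])
  show "isCont (\<lambda>y. D2 j y (axis k 1) $ i) x" "isCont (\<lambda>y. D2 k y (axis j 1) $ i) x"
    using continuous_D2 by (auto intro!: continuous_intros simp: continuous_on_eq_continuous_at)
qed (intro bounded_linear.has_derivative[OF bounded_linear_vec_nth] D D2)+

section \<open>The derivative of the extension, its continuity and its symmetry\<close>

abbreviation G :: "real^('n + 'n) \<Rightarrow> real^('n + 'n)" where
  "G \<equiv> gradient_extension F"

lemma G_nth:
  "G w $ Inl i = F (last_half w) $ i"
  "G w $ Inr j = (\<Sum>i\<in>UNIV. w $ Inl i * D (last_half w) (axis j 1) $ i)"
  by (simp_all add: gradient_extension_nth D_def)

text \<open>The product rule applied to \<open>G_nth\<close>: in each summand of the last half, the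
  first term varies x and the second varies v.\<close>

definition DG :: "real^('n + 'n) \<Rightarrow> real^('n + 'n) \<Rightarrow> real^('n + 'n)" where
  "DG w h = join_vec (D (last_half w) (last_half h))
     (\<chi> j. \<Sum>i\<in>UNIV. w $ Inl i * D2 j (last_half w) (last_half h) $ i
        + h $ Inl i * D (last_half w) (axis j 1) $ i)"

lemma DG: "(G has_derivative DG w) (at w)"
proof -
  note nth = bounded_linear.has_derivative[OF bounded_linear_vec_nth]
  note last = has_derivative_compose[OF bounded_linear_imp_has_derivative[OF bounded_linear_last_half]]
  have "((\<lambda>w. G w $ k) has_derivative (\<lambda>h. DG w h $ k)) (at w)" for k
  proof (cases k)
    case (Inl i)
    then show ?thesis
      by (simp add: G_nth DG_def) (intro nth last D)
  next
    case (Inr j)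
    then show ?thesis
      by (simp add: G_nth DG_def)
        (intro has_derivative_sum has_derivative_mult nth last[OF D2] has_derivative_ident)
  qed
  then show ?thesis
    by (subst has_derivative_componentwise_within) (auto simp: Basis_vec_def inner_axis)
qed

lemma frechet_derivative_G: "frechet_derivative G (at w) = DG w"
  using DG frechet_derivative_at by metis

lemma extends_map_G: "extends_map G F"
  by (simp add: extends_map_def G_nth)

text \<open>The four blocks of the Jacobian matrix, column by column: zero, the Jacobian of
  \<open>F\<close>, its transpose, and the Hessians of the components of \<open>F\<close> weighted
  by v. Continuity and symmetry are both checked on these entries.\<close>

lemma DG_axis:
  "DG w (axis (Inl k) 1) $ Inl i = 0"
  "DG w (axis (Inr k) 1) $ Inl i = D (last_half w) (axis k 1) $ i"
  "DG w (axis (Inl k) 1) $ Inr j = D (last_half w) (axis j 1) $ k"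
  "DG w (axis (Inr k) 1) $ Inr j = (\<Sum>i\<in>UNIV. w $ Inl i * D2 j (last_half w) (axis k 1) $ i)"
proof -
  have inl: "axis (Inl k) (1::real) $ Inl i = axis k 1 $ i"
    and inr: "axis (Inr k) (1::real) $ Inl i = 0" for i :: 'n and k :: 'n
    by (simp_all add: axis_def)
  show "DG w (axis (Inl k) 1) $ Inl i = 0"
    "DG w (axis (Inr k) 1) $ Inl i = D (last_half w) (axis k 1) $ i"
    "DG w (axis (Inl k) 1) $ Inr j = D (last_half w) (axis j 1) $ k"
    "DG w (axis (Inr k) 1) $ Inr j = (\<Sum>i\<in>UNIV. w $ Inl i * D2 j (last_half w) (axis k 1) $ i)"
    by (simp_all add: DG_def linear_0[OF linear_D] linear_0[OF linear_D2] inl inr sum_axis_mult)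
qed

text \<open>Each block entry is a combination of coordinates of \<open>w\<close> with first and
  second partial derivatives of \<open>F\<close>, all of which are continuous since \<open>F\<close>
  is C^2.\<close>

lemma C_k_G: "C_k 1 G"
proof -
  have last: "continuous_on UNIV (\<lambda>w. f (last_half w))" if "continuous_on UNIV f"
    for f :: "real^'n \<Rightarrow> real^'n"
    using continuous_on_compose2[OF that linear_continuous_on[OF bounded_linear_last_half]] by auto
  have "continuous_on UNIV (\<lambda>w. DG w (axis l 1) $ k)" for l k
    by (cases l; cases k)
      (auto simp: DG_axis intro!: continuous_intros last continuous_D continuous_D2)
  then have "continuous_on UNIV (\<lambda>w. DG w (axis l 1))" for l
    by (subst continuous_on_componentwise) (auto simp: Basis_vec_def inner_axis)
  moreover have "G differentiable (at w)" for w
    using DG differentiableI by blast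
  ultimately show ?thesis
    by (auto simp: One_nat_def frechet_derivative_G Basis_vec_def)
qed

text \<open>The off-diagonal blocks are transposes of each other, and \<open>D2_sym\<close> handles
  the Hessian block.\<close>

lemma symmetric_jacobian_G: "symmetric_jacobian G"
proof -
  have "DG w (axis l 1) $ k = DG w (axis k 1) $ l" for w k l
    by (cases l; cases k) (auto simp: DG_axis D2_sym intro!: sum.cong)
  then show ?thesis
    by (simp add: symmetric_jacobian_def jacobian_def frechet_derivative_G transpose_def matrix_def)
qed

section \<open>Nonsingularity of the extension\<close>

lemma jacobian_F: "jacobian F (at x) = matrix (D x)"
  by (simp add: jacobian_def D_def)

lemma invertible_jacobian:
  assumes "nonsingular F"
  shows "invertible (jacobian F (at x))" "invertible (transpose (jacobian F (at x)))"
  using assms by (simp_all add: nonsingular_def invertible_det_nz)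

lemma DG_halves:
  "first_half (DG w h) = D (last_half w) (last_half h)"
  "last_half h = 0 \<Longrightarrow>
    last_half (DG w h) = transpose (jacobian F (at (last_half w))) *v first_half h"
  by (simp_all add: DG_def vec_eq_iff[of "first_half _"] vec_eq_iff[of "last_half (DG w h)"]
      linear_0[OF linear_D2] matrix_vector_mult_def
      transpose_def jacobian_F matrix_def mult.commute)

text \<open>The kernel of \<open>DG w\<close> is found by back substitution through the block form:
  the upper half forces \<open>last_half h = 0\<close>, and then the lower half forces
  \<open>first_half h = 0\<close>.\<close>

lemma nonsingular_G:
  assumes "nonsingular F"
  shows "nonsingular G"
proof -
  have "det (matrix (DG w)) \<noteq> 0" for w
  proof -
    have lin: "linear (DG w)" using DG has_derivative_linear by blast
    have "h = 0" if "DG w h = 0" for h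
    proof -
      have "D (last_half w) (last_half h) = 0"
        using DG_halves(1)[of w h] that by (simp add: vec_eq_iff)
      moreover have "inj (D (last_half w))"
        using det_nz_iff_inj[OF linear_D] assms by (simp add: nonsingular_def jacobian_F)
      ultimately have last: "last_half h = 0"
        using linear_injective_0[OF linear_D] by blast
      \<comment> \<open>Once \<open>last_half h = 0\<close>, the Hessian block contributes nothing
        and only the invertible transpose remains.\<close>
      have "transpose (jacobian F (at (last_half w))) *v first_half h = 0"
        using DG_halves(2)[OF last, of w] that by (simp add: vec_eq_iff)
      then have "first_half h = 0"
        using inj_matrix_vector_mult[OF invertible_jacobian(2)[OF assms]]
        by (metis injD matrix_vector_mult_0_right)
      with last show "h = 0"
        unfolding vec_sum_eq_iff[of h 0] by (simp add: vec_eq_iff)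
    qed
    then show ?thesis
      using linear_injective_0[OF lin] det_nz_iff_inj[OF lin] by blast
  qed
  then show ?thesis
    by (simp add: nonsingular_def jacobian_def frechet_derivative_G)
qed

section \<open>Rationality and polynomiality\<close>

lemma F_nth: "F x $ i = G (join_vec 0 x) $ Inl i"
  by (simp add: G_nth)

lemma bounded_linear_join_vec_0: "bounded_linear (join_vec (0 :: real^'n))"
  by (intro linear_linear[THEN iffD2] linearI) (simp_all add: vec_sum_eq_iff vec_eq_iff)

text \<open>Forwards, \<open>G\<close> is built from \<open>F\<close>, its partial derivatives and
  the coordinates of v by sums and products. Backwards, \<open>F\<close> is read off from
  \<open>G\<close> on the slice v = 0, which is the image of a linear map.\<close>

lemma everywhere_defined_rational_G:
  "everywhere_defined_rational F \<longleftrightarrow> everywhere_defined_rational G"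
proof
  assume "everywhere_defined_rational F"
  then have F: "rational_function (\<lambda>x. F x $ i)" for i
    by (simp add: everywhere_defined_rational_iff)
  have D: "rational_function (\<lambda>x. D x v $ i)" for v i
  proof (rule rational_function_has_derivative[OF F[of i]])
    fix D' assume D': "\<And>x. ((\<lambda>x. F x $ i) has_derivative D' x) (at x)"
      "\<And>v. rational_function (\<lambda>x. D' x v)"
    show ?thesis
      using D'(2)[of v] frechet_derivative_nth[OF differentiable D'(1)] by (simp add: D_def)
  qed
  have "rational_function (\<lambda>w. G w $ k)" for k
  proof (cases k)
    case (Inl i)
    then show ?thesis
      using rational_function_compose_linear[OF F bounded_linear_last_half] by (simp add: G_nth)
  next
    case (Inr j)
    have "rational_function (\<lambda>w. w $ Inl i * D (last_half w) (axis j 1) $ i)" for i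
      by (intro rational_function_mult rational_function_polynomial real_polynomial_function.intros(1)
          bounded_linear_vec_nth
          rational_function_compose_linear[OF D bounded_linear_last_half])
    then show ?thesis
      unfolding Inr G_nth by (intro rational_function_sum finite)
  qed
  then show "everywhere_defined_rational G"
    by (simp add: everywhere_defined_rational_iff)
next
  assume "everywhere_defined_rational G"
  then show "everywhere_defined_rational F"
    unfolding everywhere_defined_rational_iff F_nth
    using rational_function_compose_linear[OF _ bounded_linear_join_vec_0] by blast
qed

text \<open>The argument for rational maps, with closure of polynomials under directional
  derivatives in place of the quotient rule.\<close>

lemma polynomial_function_G: "polynomial_function F \<longleftrightarrow> polynomial_function G"
proof
  assume "polynomial_function F"
  then have F: "real_polynomial_function (\<lambda>x. F x $ i)" for i
    by (simp add: polynomial_function_iff_nth)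
  have D: "real_polynomial_function (\<lambda>x. D x v $ i)" for v i
  proof (rule real_polynomial_function_has_derivative[OF F[of i]])
    fix D' assume D': "\<And>x. ((\<lambda>x. F x $ i) has_derivative D' x) (at x)"
      "\<And>v. real_polynomial_function (\<lambda>x. D' x v)"
    show ?thesis
      using D'(2)[of v] frechet_derivative_nth[OF differentiable D'(1)] by (simp add: D_def)
  qed
  have "real_polynomial_function (\<lambda>w. G w $ k)" for k
  proof (cases k)
    case (Inl i)
    then show ?thesis
      using real_polynomial_function_compose_linear[OF F bounded_linear_last_half] by (simp add: G_nth)
  next
    case (Inr j)
    have "real_polynomial_function (\<lambda>w. w $ Inl i * D (last_half w) (axis j 1) $ i)" for i
      by (intro real_polynomial_function.intros(4) real_polynomial_function.intros(1)[OF bounded_linear_vec_nth]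
          real_polynomial_function_compose_linear[OF D bounded_linear_last_half])
    then show ?thesis
      unfolding Inr G_nth by (intro real_polynomial_function_sum finite)
  qed
  then show "polynomial_function G"
    by (simp add: polynomial_function_iff_nth)
next
  assume "polynomial_function G"
  then show "polynomial_function F"
    unfolding polynomial_function_iff_nth F_nth
    using real_polynomial_function_compose_linear[OF _ bounded_linear_join_vec_0] by blast
qed

section \<open>Cardinality of fibers\<close>

lemma first_half_G: "first_half (G w) = F (last_half w)"
  and last_half_G: "last_half (G w) = transpose (jacobian F (at (last_half w))) *v first_half w"
  by (simp_all add: gradient_extension_def)

text \<open>Each direction injects a fiber of one map into a fiber of the other:
  \<open>last_half\<close> sends the fiber of \<open>G\<close> over \<open>y\<close> into that of
  \<open>F\<close> over \<open>first_half y\<close>, and \<open>join_vec 0\<close> sends the fiber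
  of \<open>F\<close> over \<open>a\<close> into that of \<open>G\<close> over
  \<open>join_vec a 0\<close>.\<close>

lemma fibers_at_most_G:
  assumes "nonsingular F"
  shows "fibers_at_most b F \<longleftrightarrow> fibers_at_most b G"
proof
  assume F: "fibers_at_most b F"
  show "fibers_at_most b G"
    unfolding fibers_at_most_def
  proof
    fix y
    have inj: "inj_on last_half (G -` {y})"
    proof (rule inj_onI)
      fix v w assume "v \<in> G -` {y}" "w \<in> G -` {y}" and last: "last_half v = last_half w"
      \<comment> \<open>Over a common x, the last half of the value is an invertible linear function
        of v, so it determines v.\<close>
      then have "last_half (G v) = last_half (G w)" by simp
      then have "first_half v = first_half w"
        using inj_matrix_vector_mult[OF invertible_jacobian(2)[OF assms]] last
        unfolding last_half_G by (metis injD)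
      with last show "v = w" by (simp add: vec_sum_eq_iff)
    qed
    have sub: "last_half ` (G -` {y}) \<subseteq> F -` {first_half y}"
      by (auto simp: first_half_G[symmetric])
    have "finite (F -` {first_half y})" "card (F -` {first_half y}) \<le> b"
      using F by (simp_all add: fibers_at_most_def)
    then show "finite (G -` {y}) \<and> card (G -` {y}) \<le> b"
      using inj_on_finite[OF inj sub] card_inj_on_le[OF inj sub] by simp
  qed
next
  assume G: "fibers_at_most b G"
  show "fibers_at_most b F"
    unfolding fibers_at_most_def
  proof
    fix a
    \<comment> \<open>With v = 0 the last half of the value is zero whatever x is, so the whole
      fiber of \<open>F\<close> lands over a single point.\<close>
    have "G (join_vec 0 x) = join_vec a 0" if "F x = a" for x
      using that by (simp add: gradient_extension_def)
    then have sub: "join_vec 0 ` (F -` {a}) \<subseteq> G -` {join_vec a 0}"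
      by auto
    have inj: "inj_on (join_vec 0) (F -` {a})"
      by (rule inj_onI) (metis half_join_vec(2))
    have "finite (G -` {join_vec a 0})" "card (G -` {join_vec a 0}) \<le> b"
      using G by (simp_all add: fibers_at_most_def)
    then show "finite (F -` {a}) \<and> card (F -` {a}) \<le> b"
      using inj_on_finite[OF inj sub] card_inj_on_le[OF inj sub] by simp
  qed
qed

end

theorem theorem3p10:
  fixes F :: "real^'n \<Rightarrow> real^'n"
  assumes "C_k 2 F" and "nonsingular F"
  shows "\<exists>G :: real^('n + 'n) \<Rightarrow> real^('n + 'n).
    extends_map G F \<and> C_k 1 G \<and> nonsingular G \<and>
    symmetric_jacobian G \<and>
    (everywhere_defined_rational F \<longleftrightarrow> everywhere_defined_rational G) \<and>
    (polynomial_function F \<longleftrightarrow> polynomial_function G) \<and>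
    (\<forall>b::nat. b > 0 \<longrightarrow> (fibers_at_most b F \<longleftrightarrow> fibers_at_most b G))"
proof -
  interpret C2_map F using assms(1) by unfold_locales
  show ?thesis
    using extends_map_G C_k_G nonsingular_G[OF assms(2)] symmetric_jacobian_G
      everywhere_defined_rational_G polynomial_function_G fibers_at_most_G[OF assms(2)]
    by blast
qed

end
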